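(* Let $G$ be the path graph on nodes $1,\dots,n$ ($n\ge 2$) and let $T$ be any transaction matrix on $\{1,\dots,n\}$. The dynamic program for paths (described in the context) returns an optimal solution: the fee assignment it outputs maximizes the profit $p(G,T,f_E)$ over all fee assignments $f_E\in[0,1]^E$, and the value it outputs is the corresponding maximum fee revenue $\max_{f_E}\,(p(G,T,f_E)+m)$. Its time complexity is $\mathcal{O}(n^5)$.
   Context: Setting. A transaction matrix is a symmetric matrix $T\in\mathbb{N}^{n\times n}$ ($0\in\mathbb{N}$) with zero diagonal; $T[i,j]$ is the number of transactions between $i$ and $j$ (in both directions together). The path graph $G=(V,E)$ has nodes $V=\{1,\dots,n\}$ and $m=n-1$ edges numbered $1,\dots,m$, edge $e$ joining nodes $e$ and $e+1$. A fee assignment $f_E$ gives each edge $e$ a real fee $f_e\in[0,1]$. For nodes $i<j$, $path(i,j)=\{i,i+1,\dots,j-1\}$ is the set of edges between them. The profit is $$p(G,T,f_E)=-m+\sum_{1\le i<j\le n}\ \sum_{e\in path(i,j)} f_e\cdot X_{ij}\cdot T[i,j],$$ where $X_{ij}=1$ if $\sum_{e\in path(i,j)}f_e\le 1$ and $X_{ij}=0$ otherwise (not all transactions are required to use the network). Dynamic program for paths. (1) For every $1\le i\le j\le k\le m$, compute, by going over all entries $T[u,v]$ of $T$, $$M[i,j,k]=\sum_{\substack{u,v:\ i\le u\le j<v\le k+1}}T[u,v],$$ i.e., the revenue from all transactions whose path lies within the edges $i,\dots,k$ when edge $j$ has fee $1$ and every other edge has fee $0$. (2) For every $1\le x\le y\le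 m$, with $x$ in increasing order: set $P[x,y]=M[1,x,y]$ and store the edge set $S[x,y]=\{x\}$; then for $\ell=1,\dots,x-1$: if $P[\ell,x-1]+M[\ell+1,x,y]>P[x,y]$, set $P[x,y]=P[\ell,x-1]+M[\ell+1,x,y]$ and $S[x,y]=\{x\}\cup S[\ell,x-1]$. (3) Output the value $\max_{1\le x\le y\le m}P[x,y]$ and, for a pair $(x',y')$ attaining this maximum, the fee assignment with fee $1$ on the edges in $S[x',y']$ and fee $0$ on all other edges. Running time counts elementary operations (arithmetic operations and comparisons on entries at unit cost). *)

theory Defs
  imports Complex_Main "HOL-Library.FuncSet" "HOL-Library.Landau_Symbols"
    "HOL-Library.Monad_Syntax"
begin

text \<open>
  Nodes are \<open>1, \<dots>, n\<close> and edge \<open>e\<close> joins the nodes \<open>e\<close> and \<open>e + 1\<close>. Matrices and fee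
  assignments are functions on \<open>nat\<close>; only their values on \<open>{1..n}\<close> and on \<open>edges n\<close>
  respectively are ever constrained or used.
\<close>

definition edges :: "nat \<Rightarrow> nat set" where
  "edges n = {1..n - 1}"

definition path :: "nat \<Rightarrow> nat \<Rightarrow> nat set" where
  "path i j = {i..<j}"

definition transaction_matrix :: "nat \<Rightarrow> (nat \<Rightarrow> nat \<Rightarrow> nat) \<Rightarrow> bool" where
  "transaction_matrix n T \<longleftrightarrow>
     (\<forall>i\<in>{1..n}. \<forall>j\<in>{1..n}. T i j = T j i) \<and> (\<forall>i\<in>{1..n}. T i i = 0)"

definition fee_assignments :: "nat \<Rightarrow> (nat \<Rightarrow> real) set" where
  "fee_assignments n = edges n \<rightarrow> {0..1}"

definition uses_network :: "(nat \<Rightarrow> real) \<Rightarrow> nat \<Rightarrow> nat \<Rightarrow> real" where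
  "uses_network f i j = (if (\<Sum>e\<in>path i j. f e) \<le> 1 then 1 else 0)"

definition profit :: "nat \<Rightarrow> (nat \<Rightarrow> nat \<Rightarrow> nat) \<Rightarrow> (nat \<Rightarrow> real) \<Rightarrow> real" where
  "profit n T f = - real (card (edges n)) +
     (\<Sum>(i, j)\<in>{(i, j). 1 \<le> i \<and> i < j \<and> j \<le> n}.
        \<Sum>e\<in>path i j. f e * uses_network f i j * real (T i j))"

text \<open>
  The algorithm is written in a monad that counts operations, so that its result and its
  running time come from the same program. \<open>step a\<close> is one elementary operation with result
  \<open>a\<close>: its argument is always a single arithmetic operation, comparison, table read, table
  write, or one of the unit-cost operations explained below. Boolean connectives, branching
  and passing on values are free.
\<close>

datatype 'a tm = TM (val: 'a) (time: nat)

definition bind_tm :: "'a tm \<Rightarrow> ('a \<Rightarrow> 'b tm) \<Rightarrow> 'b tm" where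
  "bind_tm c k = TM (val (k (val c))) (time c + time (k (val c)))"

adhoc_overloading Monad_Syntax.bind \<rightleftharpoons> bind_tm

definition return :: "'a \<Rightarrow> 'a tm" where
  "return a = TM a 0"

definition step :: "'a \<Rightarrow> 'a tm" where
  "step a = TM a 1"

text \<open>
  A loop over \<open>lo, \<dots>, hi\<close> threading a state: two operations per iteration (bound test and
  increment) and one for the final bound test.
\<close>

primrec for_list :: "nat list \<Rightarrow> (nat \<Rightarrow> 's \<Rightarrow> 's tm) \<Rightarrow> 's \<Rightarrow> 's tm" where
  "for_list [] body s = step s"
| "for_list (i # is) body s =
     do { s \<leftarrow> step s; s \<leftarrow> body i s; s \<leftarrow> step s; for_list is body s }"

definition for_range :: "nat \<Rightarrow> nat \<Rightarrow> (nat \<Rightarrow> 's \<Rightarrow> 's tm) \<Rightarrow> 's \<Rightarrow> 's tm" where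
  "for_range lo hi = for_list [lo..<hi + 1]"

text \<open>
  An edge set is stored as a bit vector of length \<open>m\<close>: writing one costs \<open>m\<close> operations,
  looking one up in a table (by reference) or testing membership costs one.
\<close>

definition store_set ::
    "nat \<Rightarrow> (nat \<times> nat \<Rightarrow> nat set) \<Rightarrow> nat \<times> nat \<Rightarrow> nat set \<Rightarrow> (nat \<times> nat \<Rightarrow> nat set) tm" where
  "store_set m S p A = TM (S(p := A)) m"

text \<open>Tables start out as \<open>\<lambda>_. undefined\<close>, so no initial contents are assumed.\<close>

definition compute_M_entry ::
    "nat \<Rightarrow> (nat \<Rightarrow> nat \<Rightarrow> nat) \<Rightarrow> nat \<Rightarrow> nat \<Rightarrow> nat \<Rightarrow> nat tm" where
  "compute_M_entry n T i j k = do {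
     k' \<leftarrow> step (k + 1);
     for_range 1 n (\<lambda>u. for_range 1 n (\<lambda>v a. do {
       c1 \<leftarrow> step (i \<le> u);
       c2 \<leftarrow> step (u \<le> j);
       c3 \<leftarrow> step (j < v);
       c4 \<leftarrow> step (v \<le> k');
       if c1 \<and> c2 \<and> c3 \<and> c4
       then do { t \<leftarrow> step (T u v); step (a + t) }
       else return a
     })) 0
   }"

definition compute_M ::
    "nat \<Rightarrow> nat \<Rightarrow> (nat \<Rightarrow> nat \<Rightarrow> nat) \<Rightarrow> (nat \<times> nat \<times> nat \<Rightarrow> nat) tm" where
  "compute_M n m T =
     for_range 1 m (\<lambda>i. for_range i m (\<lambda>j. for_range j m (\<lambda>k M. do {
       a \<leftarrow> compute_M_entry n T i j k;
       step (M((i, j, k) := a))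
     }))) (\<lambda>_. undefined)"

definition compute_PS ::
    "nat \<Rightarrow> (nat \<times> nat \<times> nat \<Rightarrow> nat) \<Rightarrow> ((nat \<times> nat \<Rightarrow> nat) \<times> (nat \<times> nat \<Rightarrow> nat set)) tm" where
  "compute_PS m M =
     for_range 1 m (\<lambda>x. for_range x m (\<lambda>y (P, S). do {
       a \<leftarrow> step (M (1, x, y));
       P \<leftarrow> step (P((x, y) := a));
       S \<leftarrow> store_set m S (x, y) {x};
       x' \<leftarrow> step (x - 1);
       for_range 1 x' (\<lambda>l (P, S). do {
         p \<leftarrow> step (P (l, x'));
         l' \<leftarrow> step (l + 1);
         q \<leftarrow> step (M (l', x, y));
         r \<leftarrow> step (p + q);
         b \<leftarrow> step (P (x, y));
         c \<leftarrow> step (r > b);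
         if c
         then do {
           P \<leftarrow> step (P((x, y) := r));
           S \<leftarrow> store_set m S (x, y) ({x} \<union> S (l, x'));
           return (P, S)
         }
         else return (P, S)
       }) (P, S)
     })) (\<lambda>_. undefined, \<lambda>_. undefined)"

definition max_entry :: "nat \<Rightarrow> (nat \<times> nat \<Rightarrow> nat) \<Rightarrow> nat tm" where
  "max_entry m P = do {
     r \<leftarrow> step (P (1, 1));
     for_range 1 m (\<lambda>x. for_range x m (\<lambda>y r. do {
       p \<leftarrow> step (P (x, y));
       c \<leftarrow> step (p > r);
       return (if c then p else r)
     })) r
   }"

definition max_positions :: "nat \<Rightarrow> (nat \<times> nat \<Rightarrow> nat) \<Rightarrow> nat \<Rightarrow> (nat \<times> nat) list tm" where
  "max_positions m P r =
     for_range 1 m (\<lambda>x. for_range x m (\<lambda>y ps. do {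
       p \<leftarrow> step (P (x, y));
       c \<leftarrow> step (p = r);
       if c then step ((x, y) # ps) else return ps
     })) []"

definition fees_of_set :: "nat \<Rightarrow> nat set \<Rightarrow> (nat \<Rightarrow> real) tm" where
  "fees_of_set m A =
     for_range 1 m (\<lambda>e f. do {
       c \<leftarrow> step (e \<in> A);
       step (f(e := if c then 1 else 0))
     }) (\<lambda>_. undefined)"

text \<open>
  The algorithm may use any pair attaining the maximum. This freedom is a parameter: a rule
  that picks one element of the list of all maximising pairs, at unit cost.
\<close>

definition tie_breaking_rule :: "((nat \<times> nat) list \<Rightarrow> nat \<times> nat) \<Rightarrow> bool" where
  "tie_breaking_rule pick \<longleftrightarrow> (\<forall>ps. ps \<noteq> [] \<longrightarrow> pick ps \<in> set ps)"

definition path_dp ::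
    "((nat \<times> nat) list \<Rightarrow> nat \<times> nat) \<Rightarrow> nat \<Rightarrow> (nat \<Rightarrow> nat \<Rightarrow> nat) \<Rightarrow> (nat \<times> (nat \<Rightarrow> real)) tm"
  where
  "path_dp pick n T = do {
     m \<leftarrow> step (n - 1);
     M \<leftarrow> compute_M n m T;
     (P, S) \<leftarrow> compute_PS m M;
     r \<leftarrow> max_entry m P;
     ps \<leftarrow> max_positions m P r;
     xy \<leftarrow> step (pick ps);
     A \<leftarrow> step (S xy);
     f \<leftarrow> fees_of_set m A;
     return (r, f)
   }"

end

theory Submission
  imports Defs "HOL-Analysis.Analysis"
begin

text \<open>
  Fees in \<open>{0, 1}\<close> suffice: a random shift of the integers, intersected with the prefix sums of a
  fractional fee assignment, gives a 0/1 assignment whose expected revenue is at least the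
  fractional one. The revenue of a 0/1 assignment with largest paid edge \<open>x\<close> and second largest
  paid edge \<open>l\<close> splits into the transactions ending at or before node \<open>x\<close>, which only see the
  paid edges up to \<open>l\<close>, and those crossing \<open>x\<close> but not \<open>l\<close>. This is the recurrence of the
  dynamic program.
\<close>

section \<open>The counting monad\<close>

lemma val_bind_tm [simp]: "val (bind_tm c k) = val (k (val c))"
  and time_bind_tm [simp]: "time (bind_tm c k) = time c + time (k (val c))"
  by (simp_all add: bind_tm_def)

lemma val_return [simp]: "val (return a) = a"
  and time_return [simp]: "time (return a) = 0"
  by (simp_all add: return_def)

lemma val_step [simp]: "val (step a) = a"
  and time_step [simp]: "time (step a) = 1"
  by (simp_all add: step_def)

lemma val_store_set [simp]: "val (store_set m S p A) = S(p := A)"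
  and time_store_set [simp]: "time (store_set m S p A) = m"
  by (simp_all add: store_set_def)

section \<open>Loops as folds: final states, invariants and operation counts\<close>

lemma val_for_list: "val (for_list is body s) = fold (\<lambda>i s. val (body i s)) is s"
  by (induction "is" arbitrary: s) auto

lemma val_for_range:
  "val (for_range lo hi body s) = fold (\<lambda>i s. val (body i s)) [lo..<hi + 1] s"
  by (simp add: for_range_def val_for_list)

text \<open>\<open>I i s\<close> describes the state before iteration \<open>i\<close>, hence
  \<open>Suc hi\<close> at the end. The bound on \<open>lo\<close> admits the empty loop
  \<open>lo = Suc hi\<close>, where the first and the final index agree.\<close>

lemma for_range_invariant:
  assumes "lo \<le> Suc hi" and "I lo s"
    and "\<And>i s. lo \<le> i \<Longrightarrow> i \<le> hi \<Longrightarrow> I i s \<Longrightarrow> I (Suc i) (val (body i s))"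
  shows "I (Suc hi) (val (for_range lo hi body s))"
proof -
  have "I (lo + d) (fold (\<lambda>i s. val (body i s)) [lo..<lo + d] s)" if "lo + d \<le> Suc hi" for d
    using that by (induction d) (use assms in auto)
  from this[of "Suc hi - lo"] show ?thesis
    using assms(1) by (simp add: val_for_range)
qed

lemma for_range_preserves:
  assumes "I s" and "\<And>i s. lo \<le> i \<Longrightarrow> i \<le> hi \<Longrightarrow> I s \<Longrightarrow> I (val (body i s))"
  shows "I (val (for_range lo hi body s))"
proof -
  have "I (fold (\<lambda>i s. val (body i s)) is s)" if "set is \<subseteq> {lo..hi}" for "is"
    using that assms(1) by (induction "is" arbitrary: s) (use assms(2) in auto)
  from this[of "[lo..<hi + 1]"] show ?thesis
    by (simp add: val_for_range atLeastLessThanSuc_atLeastAtMost del: upt_Suc)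
qed

text \<open>Suited to tables filled entry by entry: iteration \<open>i\<close> makes
  \<open>I\<close> true from any state, so nothing is asked of the undefined initial table, and no
  iteration may destroy \<open>I\<close> afterwards.\<close>

lemma for_range_establishes:
  assumes "i \<in> {lo..hi}" and "\<And>s. I (val (body i s))"
    and "\<And>j s. lo \<le> j \<Longrightarrow> j \<le> hi \<Longrightarrow> I s \<Longrightarrow> I (val (body j s))"
  shows "I (val (for_range lo hi body s))"
proof -
  have "lo \<le> Suc hi"
    using assms(1) by auto
  then have "i < Suc hi \<longrightarrow> I (val (for_range lo hi body s))"
  proof (rule for_range_invariant[where I = "\<lambda>j s. i < j \<longrightarrow> I s"])
    show "i < lo \<longrightarrow> I s"
      using assms(1) by auto
  next
    fix j s
    assume "lo \<le> j" "j \<le> hi" "i < j \<longrightarrow> I s"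
    then show "i < Suc j \<longrightarrow> I (val (body j s))"
      using assms(2,3) by (cases "i = j") auto
  qed
  then show ?thesis
    using assms(1) by auto
qed

lemma for_range_sum:
  fixes g :: "nat \<Rightarrow> 'a::comm_monoid_add"
  assumes "\<And>i s. val (body i s) = s + g i"
  shows "val (for_range lo hi body s) = s + (\<Sum>i=lo..hi. g i)"
proof -
  have "fold (\<lambda>i s. val (body i s)) is s = s + sum_list (map g is)" for "is"
    by (induction "is" arbitrary: s) (auto simp: assms add.assoc)
  then show ?thesis
    by (simp add: val_for_range sum_list_distinct_conv_sum_set atLeastLessThanSuc_atLeastAtMost
        del: upt_Suc)
qed

lemma time_for_list_le:
  assumes "\<And>i s. i \<in> set is \<Longrightarrow> time (body i s) \<le> c"
  shows "time (for_list is body s) \<le> length is * (c + 2) + 1"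
  using assms
proof (induction "is" arbitrary: s)
  case (Cons i "is")
  have "time (for_list is body (val (body i s))) \<le> length is * (c + 2) + 1"
    by (rule Cons.IH) (use Cons.prems in auto)
  moreover have "time (body i s) \<le> c"
    using Cons.prems by auto
  ultimately show ?case
    by simp
qed simp

text \<open>The added 3 pays for the two bookkeeping operations per iteration and the final bound
  test, each absorbed into a power of \<open>n\<close>. Applying the rule once per loop level bounds
  nested loops.\<close>

lemma time_for_range_le:
  assumes "\<And>i s. lo \<le> i \<Longrightarrow> i \<le> hi \<Longrightarrow> time (body i s) \<le> c * n ^ d"
    and "1 \<le> lo" "hi \<le> n" "1 \<le> n"
  shows "time (for_range lo hi body s) \<le> (c + 3) * n ^ Suc d"
proof -
  have "time (for_range lo hi body s) \<le> (Suc hi - lo) * (c * n ^ d + 2) + 1"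
    using time_for_list_le[of "[lo..<hi + 1]" body "c * n ^ d" s] assms(1)
    by (simp add: for_range_def del: upt_Suc)
  also have "\<dots> \<le> n * (c * n ^ d + 2 * n ^ d) + n * n ^ d"
    using assms(2-4) by (intro add_mono mult_mono) auto
  also have "\<dots> = (c + 3) * n ^ Suc d"
    by (simp add: algebra_simps)
  finally show ?thesis .
qed

section \<open>Revenue of 0/1 fee assignments\<close>

definition node_pairs :: "nat \<Rightarrow> (nat \<times> nat) set" where
  "node_pairs n = {(i, j). 1 \<le> i \<and> i < j \<and> j \<le> n}"

lemma in_node_pairs_iff [simp]: "(i, j) \<in> node_pairs n \<longleftrightarrow> 1 \<le> i \<and> i < j \<and> j \<le> n"
  by (simp add: node_pairs_def)

lemma finite_node_pairs [simp]: "finite (node_pairs n)"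
  by (rule finite_subset[of _ "{..n} \<times> {..n}"]) (auto simp: node_pairs_def)

definition revenue :: "nat \<Rightarrow> (nat \<Rightarrow> nat \<Rightarrow> nat) \<Rightarrow> (nat \<Rightarrow> real) \<Rightarrow> real" where
  "revenue n T f = (\<Sum>(i, j)\<in>node_pairs n. uses_network f i j * real (T i j) * (\<Sum>e=i..<j. f e))"

lemma profit_eq_revenue: "profit n T f + real (card (edges n)) = revenue n T f"
  by (simp add: profit_def revenue_def node_pairs_def Defs.path_def case_prod_unfold
      sum_distrib_left mult_ac)

text \<open>With fee 1 on \<open>A\<close> and 0 elsewhere, a path without an edge of
  \<open>A\<close> pays nothing and one with two or more exceeds the budget of 1. The network is cut
  off after edge \<open>y\<close>, that is, after node \<open>y + 1\<close>.\<close>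

definition set_revenue :: "(nat \<Rightarrow> nat \<Rightarrow> nat) \<Rightarrow> nat set \<Rightarrow> nat \<Rightarrow> nat" where
  "set_revenue T A y =
     (\<Sum>(i, j)\<in>node_pairs (y + 1). if card (A \<inter> {i..<j}) = 1 then T i j else 0)"

text \<open>Closed form of the table entry \<open>M[i,j,k]\<close> of the dynamic program.\<close>

definition crossing :: "(nat \<Rightarrow> nat \<Rightarrow> nat) \<Rightarrow> nat \<Rightarrow> nat \<Rightarrow> nat \<Rightarrow> nat" where
  "crossing T i j k = (\<Sum>(u, v)\<in>{i..j} \<times> {j + 1..k + 1}. T u v)"

lemma revenue_indicator:
  assumes "2 \<le> n" and "\<And>e. e \<in> {1..n - 1} \<Longrightarrow> f e = of_bool (e \<in> A)"
  shows "revenue n T f = real (set_revenue T A (n - 1))"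
proof -
  have "uses_network f i j * real (T i j) * (\<Sum>e=i..<j. f e) =
      real (if card (A \<inter> {i..<j}) = 1 then T i j else 0)" if "1 \<le> i" "i < j" "j \<le> n" for i j
  proof -
    have "(\<Sum>e=i..<j. f e) = (\<Sum>e=i..<j. of_bool (e \<in> A))"
      using that assms by (intro sum.cong) auto
    also have "\<dots> = real (card (A \<inter> {i..<j}))"
      by (simp add: Int_commute)
    finally show ?thesis
      by (simp add: uses_network_def Defs.path_def le_Suc_eq)
  qed
  then show ?thesis
    using assms(1) by (auto simp: revenue_def set_revenue_def intro!: sum.cong)
qed

text \<open>Needed because a maximising pair \<open>(x, y)\<close> may have \<open>y\<close> below
  the last edge: extending the path loses no revenue.\<close>

lemma set_revenue_mono: "y \<le> z \<Longrightarrow> set_revenue T A y \<le> set_revenue T A z"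
  unfolding set_revenue_def by (intro sum_mono2) auto

lemma set_revenue_empty [simp]: "set_revenue T {} y = 0"
  by (simp add: set_revenue_def case_prod_unfold)

text \<open>Edge \<open>x\<close> is the largest paid edge. Paths ending at node \<open>x\<close> or
  earlier miss it, paths starting after node \<open>x\<close> meet no paid edge, and all others
  contain it, so they pay iff they avoid \<open>B\<close>. Hypothesis \<open>l\<close> covers two
  cases at once: \<open>l\<close> is the largest element of \<open>B\<close>, or 0 if
  \<open>B\<close> is empty.\<close>

lemma set_revenue_insert:
  assumes "1 \<le> x" "x \<le> y" "B \<subseteq> {..<x}"
    and l: "\<And>i. 1 \<le> i \<Longrightarrow> i \<le> x \<Longrightarrow> B \<inter> {i..<x} = {} \<longleftrightarrow> l < i"
  shows "set_revenue T (insert x B) y = set_revenue T B (x - 1) + crossing T (l + 1) x y"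
proof -
  let ?h = "\<lambda>(i, j). if card (insert x B \<inter> {i..<j}) = 1 then T i j else 0"
  let ?left = "node_pairs x" and ?over = "{1..x} \<times> {x + 1..y + 1}"
  have finB: "finite B"
    using assms(3) finite_subset by blast
  have "set_revenue T (insert x B) y = (\<Sum>p\<in>?left \<union> ?over. ?h p)"
    unfolding set_revenue_def
  proof (rule sum.mono_neutral_right)
    show "?left \<union> ?over \<subseteq> node_pairs (y + 1)"
      using assms by auto
    show "\<forall>p\<in>node_pairs (y + 1) - (?left \<union> ?over). ?h p = 0"
    proof
      fix p
      assume p: "p \<in> node_pairs (y + 1) - (?left \<union> ?over)"
      obtain i j where ij: "p = (i, j)" "x < i"
        using p by (cases p) auto
      then have "insert x B \<inter> {i..<j} = {}"
        using assms(3) by auto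
      then show "?h p = 0"
        using ij by simp
    qed
  qed simp
  also have "\<dots> = (\<Sum>p\<in>?left. ?h p) + (\<Sum>p\<in>?over. ?h p)"
    by (intro sum.union_disjoint) auto
  also have "(\<Sum>p\<in>?left. ?h p) = set_revenue T B (x - 1)"
    using assms(1) unfolding set_revenue_def by (intro sum.cong) auto
  also have "(\<Sum>p\<in>?over. ?h p) = (\<Sum>(i, j)\<in>?over. if l < i then T i j else 0)"
  proof (intro sum.cong refl)
    fix p
    assume "p \<in> ?over"
    then obtain i j where p: "p = (i, j)" "1 \<le> i" "i \<le> x" "x < j"
      by (cases p) auto
    then have eq: "insert x B \<inter> {i..<j} = insert x (B \<inter> {i..<x})"
      using assms(3) by auto
    have "card (insert x B \<inter> {i..<j}) = Suc (card (B \<inter> {i..<x}))"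
      unfolding eq using finB by (subst card_insert_disjoint) auto
    then have "card (insert x B \<inter> {i..<j}) = 1 \<longleftrightarrow> l < i"
      using l[OF p(2,3)] finB by simp
    then show "?h p = (case p of (i, j) \<Rightarrow> if l < i then T i j else 0)"
      using p by simp
  qed
  also have "\<dots> = crossing T (l + 1) x y"
    unfolding crossing_def by (rule sum.mono_neutral_cong_right) (auto split: if_splits)
  finally show ?thesis .
qed

section \<open>Rounding fractional fees\<close>

text \<open>With \<open>r = frac x\<close>, the integrand is the floor of \<open>x\<close> up to
  \<open>r\<close> and one less afterwards. The two pieces contribute \<open>r\<close> times the
  floor and \<open>1 - r\<close> times the floor minus 1, in total \<open>x - 1\<close>.\<close>

lemma has_integral_floor_diff:
  fixes x :: real
  shows "((\<lambda>\<theta>. real_of_int \<lfloor>x - \<theta>\<rfloor>) has_integral x - 1) {0..1}"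
proof -
  define r where "r = frac x"
  have r: "0 \<le> r" "r < 1" "x = \<lfloor>x\<rfloor> + r"
    by (simp_all add: r_def frac_lt_1, simp add: frac_def)
  have "((\<lambda>\<theta>. real_of_int \<lfloor>x - \<theta>\<rfloor>) has_integral (r - 0) *\<^sub>R real_of_int \<lfloor>x\<rfloor>) {0..r}"
  proof (rule has_integral_eq)
    show "((\<lambda>\<theta>. real_of_int \<lfloor>x\<rfloor>) has_integral (r - 0) *\<^sub>R real_of_int \<lfloor>x\<rfloor>) {0..r}"
      using has_integral_const_real[of "real_of_int \<lfloor>x\<rfloor>" 0 r] r by simp
  next
    fix \<theta>
    assume "\<theta> \<in> {0..r}"
    then have "\<lfloor>x - \<theta>\<rfloor> = \<lfloor>x\<rfloor>"
      using r by (subst floor_unique[of "\<lfloor>x\<rfloor>"]) auto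
    then show "real_of_int \<lfloor>x\<rfloor> = real_of_int \<lfloor>x - \<theta>\<rfloor>"
      by simp
  qed
  moreover have
    "((\<lambda>\<theta>. real_of_int \<lfloor>x - \<theta>\<rfloor>) has_integral (1 - r) *\<^sub>R (real_of_int \<lfloor>x\<rfloor> - 1)) {r..1}"
  \<comment> \<open>At \<open>r\<close> itself the integrand still has the value of the left piece,
    so this point is exempted.\<close>
  proof (rule has_integral_spike_finite[of "{r}"])
    show "((\<lambda>\<theta>. real_of_int \<lfloor>x\<rfloor> - 1) has_integral (1 - r) *\<^sub>R (real_of_int \<lfloor>x\<rfloor> - 1)) {r..1}"
      using has_integral_const_real[of "real_of_int \<lfloor>x\<rfloor> - 1" r 1] r by simp
  next
    fix \<theta>
    assume "\<theta> \<in> {r..1} - {r}"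
    then have "\<lfloor>x - \<theta>\<rfloor> = \<lfloor>x\<rfloor> - 1"
      using r by (subst floor_unique[of "\<lfloor>x\<rfloor> - 1"]) auto
    then show "real_of_int \<lfloor>x - \<theta>\<rfloor> = real_of_int \<lfloor>x\<rfloor> - 1"
      by simp
  qed simp
  ultimately have "((\<lambda>\<theta>. real_of_int \<lfloor>x - \<theta>\<rfloor>) has_integral
      (r - 0) *\<^sub>R real_of_int \<lfloor>x\<rfloor> + (1 - r) *\<^sub>R (real_of_int \<lfloor>x\<rfloor> - 1)) {0..1}"
    using r by (intro has_integral_combine[of 0 r 1]) auto
  moreover have "(r - 0) *\<^sub>R real_of_int \<lfloor>x\<rfloor> + (1 - r) *\<^sub>R (real_of_int \<lfloor>x\<rfloor> - 1) = x - 1"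
    using r by (simp add: algebra_simps)
  ultimately show ?thesis
    by simp
qed

text \<open>Used twice in the rounding: for a single edge it yields a fee of 0 or 1, and for a path
  of total fee at most 1 it shows that at most one edge is paid.\<close>

lemma floor_diff_of_bool:
  fixes x y :: real
  assumes "x \<le> y" "y \<le> x + 1"
  shows "real_of_int (\<lfloor>y\<rfloor> - \<lfloor>x\<rfloor>) = of_bool (\<lfloor>x\<rfloor> < \<lfloor>y\<rfloor>)"
proof -
  have "\<lfloor>x\<rfloor> \<le> \<lfloor>y\<rfloor>" "\<lfloor>y\<rfloor> \<le> \<lfloor>x\<rfloor> + 1"
    using assms floor_mono[of x y] floor_mono[of y "x + 1"] by auto
  then show ?thesis
    by auto
qed

text \<open>
  Edge \<open>e\<close> receives fee 1 iff some point of \<open>\<theta> + \<int>\<close> lies in the interval of length \<open>f e\<close>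
  between consecutive prefix sums of the fees. The collected fees of a path of total fee at most 1
  then average, over \<open>\<theta>\<close> uniform in \<open>[0, 1]\<close>, to exactly its fractional fee.
\<close>

lemma revenue_le_of_set_revenue_le:
  assumes n: "2 \<le> n" and f: "f \<in> fee_assignments n"
    and R: "\<And>A. A \<subseteq> {1..n - 1} \<Longrightarrow> real (set_revenue T A (n - 1)) \<le> R"
  shows "revenue n T f \<le> R"
proof -
  define F where "F i = (\<Sum>e=1..<i. f e)" for i
  have f01: "0 \<le> f e" "f e \<le> 1" if "1 \<le> e" "e < n" for e
    using f that by (auto simp: fee_assignments_def edges_def Pi_def)
  have F_diff: "(\<Sum>e=i..<j. f e) = F j - F i" if "1 \<le> i" "i \<le> j" for i j
    using sum.atLeastLessThan_concat[of 1 i j f] that by (simp add: F_def)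
  define Q where "Q = {(i, j) \<in> node_pairs n. F j - F i \<le> 1}"
  have finQ: "finite Q"
    by (rule finite_subset[of _ "node_pairs n"]) (auto simp: Q_def)
  \<comment> \<open>Subtracting 1 from both prefix sums cancels, but matches the value of the floor
    integrals.\<close>
  have rev: "revenue n T f = (\<Sum>(i, j)\<in>Q. real (T i j) * ((F j - 1) - (F i - 1)))"
    unfolding revenue_def
    by (rule sum.mono_neutral_cong_right)
      (auto simp: Q_def uses_network_def Defs.path_def F_diff split: if_splits)
  let ?G = "\<lambda>\<theta>. \<Sum>(i, j)\<in>Q. real (T i j) *
      (real_of_int \<lfloor>F j - \<theta>\<rfloor> - real_of_int \<lfloor>F i - \<theta>\<rfloor>)"
  have int: "(?G has_integral revenue n T f) {0..1}"
    unfolding rev case_prod_unfold using finQ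
    by (intro has_integral_sum has_integral_mult_right has_integral_diff has_integral_floor_diff)
  \<comment> \<open>The bound holds for each shift separately, since each one comes from an actual
    edge set \<open>A\<close>.\<close>
  have le: "?G \<theta> \<le> R" for \<theta>
  proof -
    define A where "A = {e \<in> {1..n - 1}. \<lfloor>F e - \<theta>\<rfloor> < \<lfloor>F (Suc e) - \<theta>\<rfloor>}"
    have edge: "of_bool (e \<in> A) = real_of_int \<lfloor>F (Suc e) - \<theta>\<rfloor> - real_of_int \<lfloor>F e - \<theta>\<rfloor>"
      if "1 \<le> e" "e < n" for e
    proof -
      have "F (Suc e) = F e + f e"
        using that by (simp add: F_def)
      then show ?thesis
        using floor_diff_of_bool[of "F e - \<theta>" "F (Suc e) - \<theta>"] f01[OF that] that
        by (auto simp: A_def)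
    qed
    have card: "real (card (A \<inter> {i..<j})) = real_of_int \<lfloor>F j - \<theta>\<rfloor> - real_of_int \<lfloor>F i - \<theta>\<rfloor>"
      if "1 \<le> i" "i < j" "j \<le> n" for i j
    proof -
      have "real (card (A \<inter> {i..<j})) = (\<Sum>e=i..<j. of_bool (e \<in> A))"
        by (simp add: Int_commute)
      also have "\<dots> = (\<Sum>e=i..<j. real_of_int \<lfloor>F (Suc e) - \<theta>\<rfloor> - real_of_int \<lfloor>F e - \<theta>\<rfloor>)"
        using that by (intro sum.cong edge) auto
      also have "\<dots> = real_of_int \<lfloor>F j - \<theta>\<rfloor> - real_of_int \<lfloor>F i - \<theta>\<rfloor>"
        using that by (intro sum_Suc_diff') simp
      finally show ?thesis .
    qed
    \<comment> \<open>The floor difference counts the paid edges of the path; on \<open>Q\<close> it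
      is 0 or 1, so the summands agree.\<close>
    have "?G \<theta> \<le> (\<Sum>(i, j)\<in>Q. real (if card (A \<inter> {i..<j}) = 1 then T i j else 0))"
    proof (intro sum_mono, clarify)
      fix i j
      assume "(i, j) \<in> Q"
      then have ij: "1 \<le> i" "i < j" "j \<le> n" "F j - F i \<le> 1"
        by (auto simp: Q_def)
      have "0 \<le> (\<Sum>e=i..<j. f e)"
        using ij f01 by (intro sum_nonneg) auto
      then have "F i \<le> F j"
        using F_diff[of i j] ij by simp
      then show "real (T i j) * (real_of_int \<lfloor>F j - \<theta>\<rfloor> - real_of_int \<lfloor>F i - \<theta>\<rfloor>)
          \<le> real (if card (A \<inter> {i..<j}) = 1 then T i j else 0)"
        using floor_diff_of_bool[of "F i - \<theta>" "F j - \<theta>"] card[OF ij(1-3)] ij(4)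
        by (auto simp: of_bool_def split: if_splits)
    qed
    \<comment> \<open>Paths too expensive under \<open>f\<close> may pay under \<open>A\<close>;
      this can only add revenue.\<close>
    also have "\<dots> \<le> (\<Sum>(i, j)\<in>node_pairs n. real (if card (A \<inter> {i..<j}) = 1 then T i j else 0))"
      by (intro sum_mono2) (auto simp: Q_def)
    also have "\<dots> = real (set_revenue T A (n - 1))"
      using n by (simp add: set_revenue_def case_prod_unfold)
    also have "\<dots> \<le> R"
      by (rule R) (auto simp: A_def)
    finally show ?thesis .
  qed
  have "((\<lambda>_. R) has_integral R) {0..1::real}"
    using has_integral_const_real[of R 0 1] by simp
  from has_integral_le[OF int this le] show ?thesis .
qed

section \<open>Correctness of the tables\<close>

lemma val_compute_M_entry:
  assumes "1 \<le> i" "k + 1 \<le> n"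
  shows "val (compute_M_entry n T i j k) = crossing T i j k"
proof -
  let ?h = "\<lambda>u v. if i \<le> u \<and> u \<le> j \<and> j < v \<and> v \<le> k + 1 then T u v else 0"
  have "val (compute_M_entry n T i j k) = 0 + (\<Sum>u=1..n. \<Sum>v=1..n. ?h u v)"
    unfolding compute_M_entry_def val_bind_tm val_step
    by (intro for_range_sum) simp
  also have "\<dots> = (\<Sum>(u, v)\<in>{1..n} \<times> {1..n}. ?h u v)"
    by (simp add: sum.cartesian_product)
  also have "\<dots> = crossing T i j k"
    unfolding crossing_def using assms
    by (intro sum.mono_neutral_cong_right) (auto split: if_splits)
  finally show ?thesis .
qed

text \<open>A single entry is followed through the nested loops: its own iteration sets it whatever
  the state, and any other iteration leaves it correct.\<close>

lemma compute_M_correct: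
  assumes ijk: "1 \<le> i" "i \<le> j" "j \<le> k" "k \<le> m" and "m + 1 \<le> n"
  shows "val (compute_M n m T) (i, j, k) = crossing T i j k"
proof -
  let ?I = "\<lambda>M. M (i, j, k) = crossing T i j k"
  have entry: "val (compute_M_entry n T i j k) = crossing T i j k"
    using assms by (intro val_compute_M_entry) auto
  show ?thesis
    unfolding compute_M_def
  proof (rule for_range_establishes[where i = i and I = ?I], goal_cases)
    case (2 M)
    show ?case
    proof (rule for_range_establishes[where i = j and I = ?I], goal_cases)
      case (2 M)
      show ?case
        by (rule for_range_establishes[where i = k and I = ?I]) (use ijk entry in auto)
    next
      case (3 j' M)
      show ?case
        by (rule for_range_preserves[where I = ?I]) (use 3 entry in auto)
    qed (use ijk in simp)
  next
    case (3 i' M)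
    show ?case
      by (intro for_range_preserves[where I = ?I]) (use 3 entry in auto)
  qed (use ijk in simp)
qed

text \<open>
  \<open>A\<close> is an optimal choice, of value \<open>p\<close>, among the edge sets whose largest element is \<open>x\<close> and whose
  second largest element, if there is one, is below \<open>l\<close>; entry \<open>(x, y)\<close> of the tables is final
  once \<open>l = x\<close>.
\<close>

definition dp_entry ::
    "(nat \<Rightarrow> nat \<Rightarrow> nat) \<Rightarrow> nat \<Rightarrow> nat \<Rightarrow> nat \<Rightarrow> nat \<Rightarrow> nat set \<Rightarrow> bool" where
  "dp_entry T x l y p A \<longleftrightarrow>
     A \<subseteq> insert x {1..<l} \<and> x \<in> A \<and> set_revenue T A y = p \<and>
     (\<forall>B. B \<subseteq> insert x {1..<l} \<longrightarrow> x \<in> B \<longrightarrow> set_revenue T B y \<le> p)"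

lemma dp_entryD:
  assumes "dp_entry T x l y p A"
  shows "A \<subseteq> insert x {1..<l}" "x \<in> A" "set_revenue T A y = p"
    and "\<And>B. B \<subseteq> insert x {1..<l} \<Longrightarrow> x \<in> B \<Longrightarrow> set_revenue T B y \<le> p"
  using assms unfolding dp_entry_def by blast+

lemma dp_entry_init:
  assumes "1 \<le> x" "x \<le> y"
  shows "dp_entry T x 1 y (crossing T 1 x y) {x}"
proof -
  have "set_revenue T {x} y = crossing T 1 x y"
    \<comment> \<open>The index 0 stands for the missing second largest edge.\<close>
    using set_revenue_insert[of x y "{}" 0 T] assms by simp
  moreover have "set_revenue T B y \<le> set_revenue T {x} y" if "B \<subseteq> {x}" "x \<in> B" for B
    using that subset_singletonD by fastforce
  ultimately show ?thesis
    by (simp add: dp_entry_def)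
qed

lemma dp_entry_step:
  assumes xy: "x \<le> y" and l: "1 \<le> l" "l < x"
    and old: "dp_entry T x l y p A" and sub: "dp_entry T l l (x - 1) q B"
  defines "r \<equiv> q + crossing T (l + 1) x y"
  shows "dp_entry T x (Suc l) y (if p < r then r else p) (if p < r then insert x B else A)"
proof -
  have extend: "set_revenue T (insert x C) y = set_revenue T C (x - 1) + crossing T (l + 1) x y"
    if "C \<subseteq> {1..l}" "l \<in> C" for C
    using that l xy by (intro set_revenue_insert) (auto simp: not_less)
  have l_set: "insert l {1..<l} = {1..l}"
    using l by auto
  note A = dp_entryD[OF old]
  have B: "B \<subseteq> {1..l}" "l \<in> B" "set_revenue T B (x - 1) = q"
    and B_opt: "\<And>C. C \<subseteq> {1..l} \<Longrightarrow> l \<in> C \<Longrightarrow> set_revenue T C (x - 1) \<le> q"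
    using dp_entryD[OF sub] unfolding l_set by blast+
  have upper: "set_revenue T C y \<le> max p r" if C: "C \<subseteq> insert x {1..<Suc l}" "x \<in> C" for C
  proof (cases "l \<in> C")
    case True
    have "set_revenue T (insert x (C - {x})) y = set_revenue T (C - {x}) (x - 1) + crossing T (l + 1) x y"
      using C True l by (intro extend) auto
    moreover have "set_revenue T (C - {x}) (x - 1) \<le> q"
      using C True l by (intro B_opt) auto
    ultimately show ?thesis
      using C(2) by (simp add: insert_absorb r_def)
  next
    case False
    then have "C \<subseteq> insert x {1..<l}"
      using C less_Suc_eq by fastforce
    then show ?thesis
      using A(4) C(2) by (intro max.coboundedI1) simp
  qed
  show ?thesis
  proof (cases "p < r")
    case True
    have "set_revenue T (insert x B) y = r"
      using B extend[OF B(1,2)] by (simp add: r_def)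
    moreover have "insert x B \<subseteq> insert x {1..<Suc l}"
      using B(1) by auto
    moreover have "set_revenue T C y \<le> r" if "C \<subseteq> insert x {1..<Suc l}" "x \<in> C" for C
      using upper[OF that] True by simp
    ultimately show ?thesis
      using True by (simp add: dp_entry_def)
  next
    case False
    have "A \<subseteq> insert x {1..<Suc l}"
      using A(1) by auto
    moreover have "set_revenue T C y \<le> p" if "C \<subseteq> insert x {1..<Suc l}" "x \<in> C" for C
      using upper[OF that] False by simp
    ultimately show ?thesis
      using False A(2,3) by (simp add: dp_entry_def)
  qed
qed

text \<open>The inner loop body of \<open>compute_PS\<close> gets a name so that its value and cost
  can be stated outside the nested loops.\<close>

definition relax ::
    "nat \<Rightarrow> (nat \<times> nat \<times> nat \<Rightarrow> nat) \<Rightarrow> nat \<Rightarrow> nat \<Rightarrow> nat \<Rightarrow> nat \<Rightarrow>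
     (nat \<times> nat \<Rightarrow> nat) \<times> (nat \<times> nat \<Rightarrow> nat set) \<Rightarrow>
     ((nat \<times> nat \<Rightarrow> nat) \<times> (nat \<times> nat \<Rightarrow> nat set)) tm" where
  "relax m M x x' y = (\<lambda>l (P, S). do {
     p \<leftarrow> step (P (l, x'));
     l' \<leftarrow> step (l + 1);
     q \<leftarrow> step (M (l', x, y));
     r \<leftarrow> step (p + q);
     b \<leftarrow> step (P (x, y));
     c \<leftarrow> step (r > b);
     if c
     then do {
       P \<leftarrow> step (P((x, y) := r));
       S \<leftarrow> store_set m S (x, y) ({x} \<union> S (l, x'));
       return (P, S)
     }
     else return (P, S)
   })"

lemma compute_PS_eq:
  "compute_PS m M =
     for_range 1 m (\<lambda>x. for_range x m (\<lambda>y (P, S). do {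
       a \<leftarrow> step (M (1, x, y));
       P \<leftarrow> step (P((x, y) := a));
       S \<leftarrow> store_set m S (x, y) {x};
       x' \<leftarrow> step (x - 1);
       for_range 1 x' (relax m M x x' y) (P, S)
     })) (\<lambda>_. undefined, \<lambda>_. undefined)"
  unfolding compute_PS_def relax_def ..

lemma val_relax:
  "val (relax m M x x' y l (P, S)) =
     (let r = P (l, x') + M (l + 1, x, y)
      in if P (x, y) < r then (P((x, y) := r), S((x, y) := insert x (S (l, x')))) else (P, S))"
  by (simp add: relax_def Let_def)

lemma time_relax: "time (relax m M x x' y l s) \<le> m + 7"
  by (simp add: relax_def split: prod.split)

lemma compute_PS_correct:
  assumes M: "\<And>i j k. 1 \<le> i \<Longrightarrow> i \<le> j \<Longrightarrow> j \<le> k \<Longrightarrow> k \<le> m \<Longrightarrow> M (i, j, k) = crossing T i j k"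
    and PS: "val (compute_PS m M) = (P, S)"
    and "1 \<le> x" "x \<le> y" "y \<le> m"
  shows "dp_entry T x x y (P (x, y)) (S (x, y))"
proof -
  \<comment> \<open>\<open>D\<close> will be the set of finished positions: all earlier rows, and
    the part of the current row before \<open>y\<close>.\<close>
  define ok where "ok D s \<longleftrightarrow> (\<forall>(x, y)\<in>D. dp_entry T x x y (fst s (x, y)) (snd s (x, y)))"
    for D and s :: "(nat \<times> nat \<Rightarrow> nat) \<times> (nat \<times> nat \<Rightarrow> nat set)"
  define rows where "rows x = {(x', y). 1 \<le> x' \<and> x' < x \<and> x' \<le> y \<and> y \<le> m}" for x
  have "ok (rows (Suc m)) (val (compute_PS m M))"
    unfolding compute_PS_eq
  proof (rule for_range_invariant[where I = "\<lambda>x. ok (rows x)"], goal_cases)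
    case (3 x s)
    have rows_Suc: "rows (Suc x) = rows x \<union> {x} \<times> {x..<Suc m}"
      using 3(1) by (auto simp: rows_def)
    show ?case
      unfolding rows_Suc
    proof (rule for_range_invariant[where I = "\<lambda>y. ok (rows x \<union> {x} \<times> {x..<y})"], goal_cases)
      case (3 y s)
      define D where "D = rows x \<union> {x} \<times> {x..<y}"
      obtain P S where s: "s = (P, S)"
        by (cases s)
      let ?body = "relax m M x (x - 1) y"
      let ?s' = "val (for_range 1 (x - 1) ?body (P((x, y) := M (1, x, y)), S((x, y) := {x})))"
      have x: "1 \<le> x" "x \<le> y" "y \<le> m"
        using 3 \<open>1 \<le> x\<close> by auto
      \<comment> \<open>The inner loop writes only to \<open>(x, y)\<close>, which lies outside
        \<open>D\<close>, so finished entries survive. It ends at \<open>Suc (x - 1) = x\<close>,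
        where the current entry is final.\<close>
      have "ok D ?s' \<and> dp_entry T x (Suc (x - 1)) y (fst ?s' (x, y)) (snd ?s' (x, y))"
      proof (rule for_range_invariant[where
            I = "\<lambda>l s. ok D s \<and> dp_entry T x l y (fst s (x, y)) (snd s (x, y))"], goal_cases)
        case 2
        have "ok D (P, S)"
          using 3(3) s by (simp add: D_def)
        then show ?case
          using dp_entry_init[OF x(1,2), of T] M[of 1 x y] x
          by (auto simp: ok_def D_def rows_def)
      next
        case (3 l s)
        obtain P S where s: "s = (P, S)"
          by (cases s)
        \<comment> \<open>The increasing order of \<open>x\<close> enters here: row \<open>l\<close>
          precedes row \<open>x\<close> and is already complete.\<close>
        have "(l, x - 1) \<in> D"
          using 3(1,2) x by (auto simp: D_def rows_def)
        then have sub: "dp_entry T l l (x - 1) (P (l, x - 1)) (S (l, x - 1))"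
          using 3(3) s by (auto simp: ok_def)
        have "dp_entry T x l y (P (x, y)) (S (x, y))"
          using 3(3) s by simp
        from dp_entry_step[OF x(2) _ _ this sub]
        have "dp_entry T x (Suc l) y (fst (val (?body l s)) (x, y)) (snd (val (?body l s)) (x, y))"
          using 3(1,2) x M[of "l + 1" x y] by (auto simp: s val_relax Let_def split: if_splits)
        moreover have "ok D (val (?body l s))"
          using 3(3) by (auto simp: s val_relax Let_def ok_def D_def rows_def)
        ultimately show ?case
          by blast
      qed (use x in simp)
      then have "ok (insert (x, y) D) ?s'"
        using x by (simp add: ok_def)
      moreover have "insert (x, y) D = rows x \<union> {x} \<times> {x..<Suc y}"
        using x by (auto simp: D_def)
      ultimately show ?case
        by (simp add: s)
    qed (use 3 in auto)
  qed (auto simp: ok_def rows_def)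
  then show ?thesis
    using assms by (auto simp: ok_def rows_def)
qed

section \<open>The maximum and the output\<close>

lemma max_entry_upper:
  assumes "1 \<le> x" "x \<le> y" "y \<le> m"
  shows "P (x, y) \<le> val (max_entry m P)"
  unfolding max_entry_def val_bind_tm
proof (rule for_range_establishes[where i = x and I = "(\<le>) (P (x, y))"], goal_cases)
  case (2 r)
  show ?case
    by (rule for_range_establishes[where i = y and I = "(\<le>) (P (x, y))"]) (use assms in auto)
next
  case (3 x' r)
  then show ?case
    by (intro for_range_preserves[where I = "(\<le>) (P (x, y))"]) auto
qed (use assms in simp)

lemma max_positions_correct:
  "set (val (max_positions m P r)) = {(x, y). 1 \<le> x \<and> x \<le> y \<and> y \<le> m \<and> P (x, y) = r}"
proof (intro equalityI subsetI)
  let ?X = "{(x, y). 1 \<le> x \<and> x \<le> y \<and> y \<le> m \<and> P (x, y) = r}"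
  have "set (val (max_positions m P r)) \<subseteq> ?X"
    unfolding max_positions_def by (intro for_range_preserves[where I = "\<lambda>ps. set ps \<subseteq> ?X"]) auto
  then show "p \<in> ?X" if "p \<in> set (val (max_positions m P r))" for p
    using that by blast
next
  fix p
  assume "p \<in> {(x, y). 1 \<le> x \<and> x \<le> y \<and> y \<le> m \<and> P (x, y) = r}"
  then obtain x y where p: "p = (x, y)" "1 \<le> x" "x \<le> y" "y \<le> m" "P (x, y) = r"
    by auto
  let ?I = "\<lambda>ps. (x, y) \<in> set ps"
  show "p \<in> set (val (max_positions m P r))"
    unfolding max_positions_def p(1)
  proof (rule for_range_establishes[where i = x and I = ?I], goal_cases)
    case (2 ps)
    show ?case
      by (rule for_range_establishes[where i = y and I = ?I]) (use p in auto)
  next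
    case (3 x' ps)
    then show ?case
      by (intro for_range_preserves[where I = ?I]) auto
  qed (use p in simp)
qed

text \<open>The running maximum starts at an entry, valid as \<open>1 \<le> m\<close>, and is only
  ever replaced by entries.\<close>

lemma max_entry_attained:
  assumes "1 \<le> m"
  shows "\<exists>x y. 1 \<le> x \<and> x \<le> y \<and> y \<le> m \<and> P (x, y) = val (max_entry m P)"
  unfolding max_entry_def val_bind_tm val_step
proof (intro for_range_preserves[where I = "\<lambda>r. \<exists>x y. 1 \<le> x \<and> x \<le> y \<and> y \<le> m \<and> P (x, y) = r"])
  show "\<exists>x y. 1 \<le> x \<and> x \<le> y \<and> y \<le> m \<and> P (x, y) = P (1, 1)"
    using assms by blast
qed auto

lemma val_fees_of_set:
  assumes "e \<in> {1..m}"
  shows "val (fees_of_set m A) e = of_bool (e \<in> A)"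
  unfolding fees_of_set_def
  by (rule for_range_establishes[where i = e and I = "\<lambda>f. f e = of_bool (e \<in> A)"])
    (use assms in auto)

lemma path_dp_correct:
  assumes n: "2 \<le> n" and pick: "tie_breaking_rule pick" and out: "val (path_dp pick n T) = (r, f)"
  shows "f \<in> fee_assignments n" and "revenue n T f = real r"
    and "\<And>g. g \<in> fee_assignments n \<Longrightarrow> revenue n T g \<le> real r"
proof -
  define m where "m = n - 1"
  have m: "1 \<le> m" "m + 1 \<le> n" "n - Suc 0 = m"
    using n by (auto simp: m_def)
  obtain P S where PS: "val (compute_PS m (val (compute_M n m T))) = (P, S)"
    by fastforce
  define xy where "xy = pick (val (max_positions m P r))"
  have r: "r = val (max_entry m P)" and f: "f = val (fees_of_set m (S xy))"
    using out by (auto simp: path_dp_def PS m xy_def)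
  have entry: "dp_entry T x x y (P (x, y)) (S (x, y))" if "1 \<le> x" "x \<le> y" "y \<le> m" for x y
    using compute_PS_correct[OF compute_M_correct PS] that m by blast
  have "val (max_positions m P r) \<noteq> []"
    using max_entry_attained[OF m(1), of P] max_positions_correct[of m P r] r by force
  then have "xy \<in> set (val (max_positions m P r))"
    using pick by (simp add: tie_breaking_rule_def xy_def)
  then obtain x y where xy: "xy = (x, y)" "1 \<le> x" "x \<le> y" "y \<le> m" "P (x, y) = r"
    by (auto simp: max_positions_correct)
  \<comment> \<open>A nonempty \<open>A\<close> is a candidate for the entry
    \<open>(Max A, m)\<close>, which is at most the maximum.\<close>
  have upper: "set_revenue T A m \<le> r" if "A \<subseteq> {1..m}" for A
  proof (cases "A = {}")
    case False
    have fin: "finite A"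
      using that finite_subset by blast
    have Max: "Max A \<in> A" "1 \<le> Max A" "Max A \<le> m"
      using Max_in[OF fin False] that by auto
    have "A \<subseteq> insert (Max A) {1..<Max A}"
    proof
      fix e
      assume "e \<in> A"
      then have "1 \<le> e" "e \<le> Max A"
        using that Max_ge[OF fin] by auto
      then show "e \<in> insert (Max A) {1..<Max A}"
        by (cases "e = Max A") simp_all
    qed
    then have "set_revenue T A m \<le> P (Max A, m)"
      using entry[of "Max A" m] Max by (intro dp_entryD(4)) auto
    also have "\<dots> \<le> r"
      unfolding r using Max by (intro max_entry_upper) auto
    finally show ?thesis .
  qed simp
  have f_ind: "f e = of_bool (e \<in> S xy)" if "e \<in> {1..n - 1}" for e
    using that unfolding f m_def by (rule val_fees_of_set)
  have "S xy \<subseteq> {1..m}" "set_revenue T (S xy) y = r"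
    using dp_entryD[OF entry[OF xy(2-4)]] xy by fastforce+
  \<comment> \<open>Passing from \<open>y\<close> to \<open>m\<close> cannot lose revenue, and
    \<open>upper\<close> forbids a gain.\<close>
  then have "set_revenue T (S xy) m = r"
    using set_revenue_mono[OF xy(4), of T "S xy"] upper[of "S xy"] by simp
  then show "revenue n T f = real r"
    using revenue_indicator[OF n f_ind] by (simp add: m_def)
  show "f \<in> fee_assignments n"
    by (auto simp: fee_assignments_def edges_def f_ind)
  show "revenue n T g \<le> real r" if "g \<in> fee_assignments n" for g
    using revenue_le_of_set_revenue_le[OF n that] upper by (simp add: m_def)
qed

section \<open>Running time\<close>

lemma time_compute_M_entry:
  assumes "1 \<le> n"
  shows "time (compute_M_entry n T i j k) \<le> 13 * n ^ 2"
proof -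
  \<comment> \<open>The 6 is four comparisons, one read and one addition; the leading 1 computes
    \<open>k + 1\<close>.\<close>
  have "time (compute_M_entry n T i j k) \<le> 1 + (6 + 3 + 3) * n ^ Suc (Suc 0)"
    unfolding compute_M_entry_def time_bind_tm time_step
    using assms by (intro add_left_mono time_for_range_le) auto
  also have "\<dots> \<le> 13 * n ^ 2"
    using assms by (simp add: power2_eq_square)
  finally show ?thesis .
qed

lemma time_compute_M:
  assumes "1 \<le> n" "m \<le> n"
  shows "time (compute_M n m T) \<le> 23 * n ^ 5"
proof -
  have "time (do { a \<leftarrow> compute_M_entry n T i j k; step (M((i, j, k) := a)) }) \<le> 14 * n ^ 2"
    for i j k M
    using time_compute_M_entry[OF assms(1), of T i j k] one_le_power[OF assms(1), of 2] by simp
  \<comment> \<open>Three loops around a quadratic entry cost give the exponent 5, the dominating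
    term.\<close>
  then have "time (compute_M n m T) \<le> (14 + 3 + 3 + 3) * n ^ Suc (Suc (Suc 2))"
    unfolding compute_M_def using assms by (intro time_for_range_le) auto
  then show ?thesis
    by simp
qed

lemma time_compute_PS:
  assumes "1 \<le> n" "m \<le> n"
  shows "time (compute_PS m M) \<le> 21 * n ^ 4"
proof -
  \<comment> \<open>Per pair \<open>(x, y)\<close>: \<open>11 * n ^ 2\<close> for the inner loop,
    whose body may store a set at cost \<open>m\<close>, plus three single operations and
    \<open>m\<close> for storing \<open>{x}\<close>.\<close>
  have "time (compute_PS m M) \<le> (15 + 3 + 3) * n ^ Suc (Suc 2)"
    unfolding compute_PS_eq
  proof (intro time_for_range_le, goal_cases)
    case (1 x s y t)
    obtain P S where t: "t = (P, S)"
      by (cases t)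
    have "time (relax m M x (x - 1) y l u) \<le> 8 * n ^ 1" for l u
      using time_relax[of m M x "x - 1" y l u] assms by simp
    then have "time (for_range 1 (x - 1) (relax m M x (x - 1) y) u) \<le> (8 + 3) * n ^ Suc 1" for u
      using 1 assms by (intro time_for_range_le) auto
    from this[of "(P((x, y) := M (1, x, y)), S((x, y) := {x}))"]
    have "time (for_range 1 (x - 1) (relax m M x (x - 1) y)
        (P((x, y) := M (1, x, y)), S((x, y) := {x}))) \<le> 11 * n ^ 2"
      by (simp add: numeral_2_eq_2)
    moreover have "n \<le> n ^ 2" "1 \<le> n ^ 2"
      using assms by (auto simp: power2_eq_square)
    ultimately show ?case
      using assms(2) by (simp add: t)
  qed (use assms in auto)
  then show ?thesis
    by simp
qed

lemma time_max_entry: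
  assumes "1 \<le> n" "m \<le> n"
  shows "time (max_entry m P) \<le> 9 * n ^ 2"
proof -
  have "time (max_entry m P) \<le> 1 + (2 + 3 + 3) * n ^ Suc (Suc 0)"
    unfolding max_entry_def time_bind_tm time_step
    using assms by (intro add_left_mono time_for_range_le) auto
  also have "\<dots> \<le> 9 * n ^ 2"
    using assms by (simp add: power2_eq_square)
  finally show ?thesis .
qed

lemma time_max_positions:
  assumes "1 \<le> n" "m \<le> n"
  shows "time (max_positions m P r) \<le> 9 * n ^ 2"
proof -
  have "time (max_positions m P r) \<le> (3 + 3 + 3) * n ^ Suc (Suc 0)"
    unfolding max_positions_def using assms by (intro time_for_range_le) auto
  then show ?thesis
    by (simp add: power2_eq_square)
qed

lemma time_fees_of_set:
  assumes "1 \<le> n" "m \<le> n"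
  shows "time (fees_of_set m A) \<le> 5 * n"
proof -
  have "time (fees_of_set m A) \<le> (2 + 3) * n ^ Suc 0"
    unfolding fees_of_set_def using assms by (intro time_for_range_le) auto
  then show ?thesis
    by simp
qed

lemma time_path_dp:
  assumes "1 \<le> n"
  shows "time (path_dp pick n T) \<le> 70 * n ^ 5"
proof -
  define m where "m = n - 1"
  have m: "m \<le> n" "n - Suc 0 = m"
    by (auto simp: m_def)
  obtain P S where PS: "val (compute_PS m (val (compute_M n m T))) = (P, S)"
    by fastforce
  define r where "r = val (max_entry m P)"
  define A where "A = S (pick (val (max_positions m P r)))"
  \<comment> \<open>The 3 counts computing \<open>m\<close>, picking a pair and looking up its edge
    set.\<close>
  have "time (path_dp pick n T) = 3 + time (compute_M n m T)
      + time (compute_PS m (val (compute_M n m T))) + time (max_entry m P)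
      + time (max_positions m P r) + time (fees_of_set m A)"
    by (simp add: path_dp_def PS m r_def A_def)
  also have "\<dots> \<le> 3 * n ^ 5 + 23 * n ^ 5 + 21 * n ^ 5 + 9 * n ^ 5 + 9 * n ^ 5 + 5 * n ^ 5"
  proof (intro add_mono)
    have pow: "n ^ d \<le> n ^ 5" if "d \<le> 5" for d
      using that assms by (intro power_increasing) auto
    show "time (compute_PS m (val (compute_M n m T))) \<le> 21 * n ^ 5"
      using time_compute_PS[OF assms m(1), of "val (compute_M n m T)"] pow[of 4] by linarith
    show "time (max_entry m P) \<le> 9 * n ^ 5"
      using time_max_entry[OF assms m(1), of P] pow[of 2] by linarith
    show "time (max_positions m P r) \<le> 9 * n ^ 5"
      using time_max_positions[OF assms m(1), of P r] pow[of 2] by linarith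
    show "time (fees_of_set m A) \<le> 5 * n ^ 5"
      using time_fees_of_set[OF assms m(1), of A] pow[of 1] by simp
  qed (use assms time_compute_M[OF assms m(1)] in auto)
  finally show ?thesis
    by simp
qed

theorem theorem2:
  "(\<forall>n T pick r f.
      2 \<le> n \<longrightarrow> transaction_matrix n T \<longrightarrow> tie_breaking_rule pick \<longrightarrow>
      val (path_dp pick n T) = (r, f) \<longrightarrow>
        is_arg_max (profit n T) (\<lambda>g. g \<in> fee_assignments n) f \<and>
        real r \<in> (\<lambda>g. profit n T g + real (card (edges n))) ` fee_assignments n \<and>
        (\<forall>g\<in>fee_assignments n. profit n T g + real (card (edges n)) \<le> real r)) \<and>
   (\<exists>t :: nat \<Rightarrow> real. t \<in> O(\<lambda>n. real n ^ 5) \<and>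
      (\<forall>n T pick.
         2 \<le> n \<longrightarrow> transaction_matrix n T \<longrightarrow> tie_breaking_rule pick \<longrightarrow>
         real (time (path_dp pick n T)) \<le> t n))"
proof (rule conjI, goal_cases)
  case 1
  show ?case
  proof (intro allI impI)
    fix n T pick r f
    assume "2 \<le> n" "tie_breaking_rule pick" "val (path_dp pick n T) = (r, f)"
    note correct = path_dp_correct[OF this]
    \<comment> \<open>The difference does not depend on the fees, so both functions have the same
      maximisers.\<close>
    have profit: "profit n T g = revenue n T g - real (card (edges n))" for g
      using profit_eq_revenue[of n T g] by simp
    show "is_arg_max (profit n T) (\<lambda>g. g \<in> fee_assignments n) f \<and>
        real r \<in> (\<lambda>g. profit n T g + real (card (edges n))) ` fee_assignments n \<and>
        (\<forall>g\<in>fee_assignments n. profit n T g + real (card (edges n)) \<le> real r)"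
      using correct by (force simp: profit is_arg_max_linorder)
  qed
next
  case 2
  have "real (time (path_dp pick n T)) \<le> 70 * real n ^ 5" if "2 \<le> n" for pick n T
    using of_nat_mono[OF time_path_dp[of n pick T], where 'a = real] that by simp
  moreover have "(\<lambda>n. 70 * real n ^ 5) \<in> O(\<lambda>n. real n ^ 5)"
    by simp
  ultimately show ?case
    by blast
qed

end
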